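(* There is an absolute constant $K$ such that the following holds. Let $M$ be a strictly convex space, $n\ge1$, $\boldsymbol{\ell}=(\ell_1,\dots,\ell_n)\in M^n$ the true locations of the agents, $\hat o\in M$ an arbitrary prediction with $\mathrm{SC}(\hat o,\boldsymbol\ell)>0$, $c>0$, and $\Delta=\frac cn\cdot\mathrm{SC}(\hat o,\boldsymbol\ell)$. Then $\mathrm{Harmonic}(\Delta)$ is $O(1+1/c^2)$-robust: for every Pure Nash Equilibrium $\tilde{\boldsymbol\ell}$ of the game induced by $\mathrm{Harmonic}(\Delta)$ with prediction $\hat o$, $$\mathbb{E}\big[\mathrm{SC}(f(\tilde{\boldsymbol\ell},\hat o),\boldsymbol\ell)\big]\le K\Big(1+\frac1{c^2}\Big)\cdot\mathrm{opt}(\boldsymbol\ell).$$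
   Context: A strictly convex space $M$ is a real normed vector space with distance $d(v_1,v_2)=\|v_1-v_2\|$ in which, for $v_1,v_2\neq0$, $\|v_1+v_2\|=\|v_1\|+\|v_2\|$ implies $v_1=\lambda v_2$ for some $\lambda>0$. The social cost of placing the facility at $f\in M$ is $\mathrm{SC}(f,\boldsymbol\ell)=\sum_{i\in[n]}d(f,\ell_i)$, and $\mathrm{opt}(\boldsymbol\ell)=\min_{o'\in M}\mathrm{SC}(o',\boldsymbol\ell)$ (assumed attained). Mechanism $\mathrm{Harmonic}(\Delta)$: given reports $\tilde{\boldsymbol\ell}=(\tilde\ell_1,\dots,\tilde\ell_n)\in M^n$ and the prediction $\hat o$, the (random) facility $f(\tilde{\boldsymbol\ell},\hat o)$ is placed at $\tilde\ell_j$ with probability $$\frac{1/(d(\tilde\ell_j,\hat o)+\Delta)}{\sum_{k=1}^n 1/(d(\tilde\ell_k,\hat o)+\Delta)},\qquad j\in[n].$$ In the induced game each agent $i$ chooses a report $\tilde\ell_i\in M$, and the cost of agent $i$ is $\mathrm{cost}_i(\tilde{\boldsymbol\ell})=\mathbb{E}[d(f(\tilde{\boldsymbol\ell},\hat o),\ell_i)]$. A Pure Nash Equilibrium is a profile $\tilde{\boldsymbol\ell}\in M^n$ such that $\mathrm{cost}_i(\tilde{\boldsymbol\ell})\le \mathrm{cost}_i(\tilde\ell_i',\tilde{\boldsymbol\ell}_{-i})$ for every $i\in[n]$ and every $\tilde\ell_i'\in M$. *)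

theory Defs
  imports "HOL-Probability.Probability"
begin

class strictly_convex_space = real_normed_vector +
  assumes strictly_convex:
    "v \<noteq> 0 \<Longrightarrow> w \<noteq> 0 \<Longrightarrow> norm (v + w) = norm v + norm w \<Longrightarrow>
      \<exists>t::real. t > 0 \<and> v = t *\<^sub>R w"

text \<open>The agents are \<open>1, \<dots>, n\<close>; a profile in \<open>M\<^sup>n\<close> is a function on \<open>nat\<close> of which only the
  values on \<open>{1..n}\<close> are used.\<close>

definition social_cost :: "nat \<Rightarrow> (nat \<Rightarrow> 'a::metric_space) \<Rightarrow> 'a \<Rightarrow> real" where
  "social_cost n l f = (\<Sum>i\<in>{1..n}. dist f (l i))"

text \<open>An infimum here; that it is a minimum is a separate hypothesis where it is needed.\<close>

definition opt :: "nat \<Rightarrow> (nat \<Rightarrow> 'a::metric_space) \<Rightarrow> real" where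
  "opt n l = (INF f. social_cost n l f)"

definition harmonic_prob ::
    "nat \<Rightarrow> real \<Rightarrow> 'a::metric_space \<Rightarrow> (nat \<Rightarrow> 'a) \<Rightarrow> nat \<Rightarrow> real" where
  "harmonic_prob n \<Delta> ohat r j =
    (1 / (dist (r j) ohat + \<Delta>)) / (\<Sum>k\<in>{1..n}. 1 / (dist (r k) ohat + \<Delta>))"

text \<open>The law of the selected agent. \<^const>\<open>embed_pmf\<close> is only meaningful on genuine mass
  functions, which this one is for \<open>n \<ge> 1\<close> and \<open>\<Delta> > 0\<close>; see \<open>pmf_harmonic_agent\<close>.\<close>

definition harmonic_agent ::
    "nat \<Rightarrow> real \<Rightarrow> 'a::metric_space \<Rightarrow> (nat \<Rightarrow> 'a) \<Rightarrow> nat pmf" where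
  "harmonic_agent n \<Delta> ohat r =
    embed_pmf (\<lambda>j. if j \<in> {1..n} then harmonic_prob n \<Delta> ohat r j else 0)"

text \<open>The law of the facility \<open>f(r, ohat)\<close> when the reports are \<open>r\<close>. Agents with a common report
  contribute jointly to its probability.\<close>

definition harmonic ::
    "nat \<Rightarrow> real \<Rightarrow> 'a::metric_space \<Rightarrow> (nat \<Rightarrow> 'a) \<Rightarrow> 'a pmf" where
  "harmonic n \<Delta> ohat r = map_pmf r (harmonic_agent n \<Delta> ohat r)"

text \<open>The cost of agent \<open>i\<close> under true locations \<open>l\<close> and reports \<open>r\<close>.\<close>

definition agent_cost ::
    "nat \<Rightarrow> real \<Rightarrow> 'a::metric_space \<Rightarrow> (nat \<Rightarrow> 'a) \<Rightarrow> nat \<Rightarrow> (nat \<Rightarrow> 'a) \<Rightarrow> real" where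
  "agent_cost n \<Delta> ohat l i r =
    measure_pmf.expectation (harmonic n \<Delta> ohat r) (\<lambda>f. dist f (l i))"

definition pure_nash ::
    "nat \<Rightarrow> real \<Rightarrow> 'a::metric_space \<Rightarrow> (nat \<Rightarrow> 'a) \<Rightarrow> (nat \<Rightarrow> 'a) \<Rightarrow> bool" where
  "pure_nash n \<Delta> ohat l r \<longleftrightarrow>
    (\<forall>i\<in>{1..n}. \<forall>x. agent_cost n \<Delta> ohat l i r \<le> agent_cost n \<Delta> ohat l i (r(i := x)))"

text \<open>The absolute constant of the robustness bound. A statement of the form
  \<open>\<exists>K. \<forall>l ohat c r. \<dots>\<close> about a space of type \<open>'a\<close> would let \<open>K\<close> depend on the space, since types
  cannot be quantified inside a formula; a constant whose definition mentions no space does not.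
  The numerical value carries no significance.\<close>

definition robustness_const :: real where
  "robustness_const = 100"

lemma pmf_harmonic_agent:
  assumes "n \<ge> 1" "\<Delta> > 0"
  shows "pmf (harmonic_agent n \<Delta> ohat r) j =
    (if j \<in> {1..n} then harmonic_prob n \<Delta> ohat r j else 0)"
proof -
  let ?w = "\<lambda>k. 1 / (dist (r k) ohat + \<Delta>)"
  let ?g = "\<lambda>j. if j \<in> {1..n} then harmonic_prob n \<Delta> ohat r j else 0"
  have w: "?w k > 0" for k
    using assms(2) by (simp add: add_nonneg_pos)
  have W: "(\<Sum>k\<in>{1..n}. ?w k) > 0"
    using assms(1) w by (intro sum_pos) auto
  have nn: "?g k \<ge> 0" for k
    using less_imp_le[OF w[of k]] less_imp_le[OF W] by (auto simp: harmonic_prob_def)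
  have "(\<Sum>k\<in>{1..n}. ?g k) = (\<Sum>k\<in>{1..n}. ?w k / (\<Sum>k\<in>{1..n}. ?w k))"
    by (intro sum.cong) (auto simp: harmonic_prob_def)
  also have "\<dots> = 1"
    using W by (subst sum_divide_distrib[symmetric]) simp
  finally have s: "(\<Sum>k\<in>{1..n}. ?g k) = 1" .
  have "(\<integral>\<^sup>+ k. ennreal (?g k) \<partial>count_space UNIV) = (\<Sum>k\<in>{1..n}. ennreal (?g k))"
    by (intro nn_integral_count_space') auto
  also have "\<dots> = ennreal (\<Sum>k\<in>{1..n}. ?g k)"
    by (rule sum_ennreal) (rule nn)
  also have "\<dots> = 1"
    unfolding s by simp
  finally show ?thesis
    unfolding harmonic_agent_def by (intro pmf_embed_pmf nn)
qed

lemma expectation_harmonic: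
  fixes h :: "'a::metric_space \<Rightarrow> real"
  assumes "n \<ge> 1" "\<Delta> > 0"
  shows "measure_pmf.expectation (harmonic n \<Delta> ohat r) h =
    (\<Sum>j\<in>{1..n}. harmonic_prob n \<Delta> ohat r j * h (r j))"
proof -
  have "measure_pmf.expectation (harmonic n \<Delta> ohat r) h =
      measure_pmf.expectation (harmonic_agent n \<Delta> ohat r) (\<lambda>j. h (r j))"
    by (simp add: harmonic_def)
  also have "\<dots> = (\<Sum>j\<in>{1..n}. pmf (harmonic_agent n \<Delta> ohat r) j *\<^sub>R h (r j))"
    by (intro integral_measure_pmf)
      (auto simp: set_pmf_iff pmf_harmonic_agent[OF assms] split: if_splits)
  also have "\<dots> = (\<Sum>j\<in>{1..n}. harmonic_prob n \<Delta> ohat r j * h (r j))"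
    by (intro sum.cong) (auto simp: pmf_harmonic_agent[OF assms])
  finally show ?thesis .
qed

end

(* In equilibrium agent i maximises (C_i - d(x, l_i)) / (d(x, ohat) + \<Delta>) over x, where C_i is her
   equilibrium cost. Comparing her report with l_i and with ohat shows that the report is no farther
   from ohat, and no farther from l_i, than l_i is from ohat, and that she misreports only if
   C_i \<ge> d(l_i, ohat) + \<Delta>. By the first fact every selection probability is at most (1 + 1/c) / n,
   and the expected social cost is at most twice that of ohat.

   Let o be an optimal location, Q the expected distance from o to the true location of the selected
   agent, and P the probability of selecting a misreporting agent. Averaging the condition for
   misreporting over those agents gives P (1 - P) d(o, ohat) + P \<Delta> \<le> 4 Q. If P \<le> 1/2, then
   P d(o, ohat) = O(Q), so the misreports displace the facility by O(Q) on average. Otherwise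
   \<Delta> = O(Q), hence ohat itself is a good location. *)

theory Submission
  imports Defs
begin

section \<open>Selection probabilities of the mechanism\<close>

lemma harmonic_prob_nonneg:
  assumes "\<Delta> > 0"
  shows "harmonic_prob n \<Delta> ohat r j \<ge> 0"
  unfolding harmonic_prob_def using assms by (intro divide_nonneg_nonneg sum_nonneg) auto

lemma harmonic_normalizer_pos:
  fixes n :: nat
  assumes "n \<ge> 1" "\<Delta> > 0"
  shows "(\<Sum>k\<in>{1..n}. 1 / (dist (r k) ohat + \<Delta>)) > 0"
  using assms by (intro sum_pos) (simp_all add: add_nonneg_pos)

lemma sum_harmonic_prob:
  assumes "n \<ge> 1" "\<Delta> > 0"
  shows "(\<Sum>j\<in>{1..n}. harmonic_prob n \<Delta> ohat r j) = 1"
  using harmonic_normalizer_pos[OF assms, of r ohat]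
  unfolding harmonic_prob_def by (subst sum_divide_distrib[symmetric]) simp

section \<open>Agent costs and equilibrium conditions\<close>

lemma agent_cost_eq:
  assumes "n \<ge> 1" "\<Delta> > 0"
  shows "agent_cost n \<Delta> ohat l i r = (\<Sum>j\<in>{1..n}. harmonic_prob n \<Delta> ohat r j * dist (r j) (l i))"
  unfolding agent_cost_def using assms by (rule expectation_harmonic)

lemma agent_cost_eq_ratio:
  assumes "n \<ge> 1" "\<Delta> > 0"
  shows "agent_cost n \<Delta> ohat l i r =
    (\<Sum>j\<in>{1..n}. dist (r j) (l i) / (dist (r j) ohat + \<Delta>)) /
    (\<Sum>j\<in>{1..n}. 1 / (dist (r j) ohat + \<Delta>))"
  by (simp add: agent_cost_eq[OF assms] harmonic_prob_def sum_divide_distrib)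

lemma agent_cost_nonneg:
  assumes "n \<ge> 1" "\<Delta> > 0"
  shows "agent_cost n \<Delta> ohat l i r \<ge> 0"
  unfolding agent_cost_eq[OF assms]
  by (intro sum_nonneg mult_nonneg_nonneg harmonic_prob_nonneg assms) auto

text \<open>As a function of her own report \<open>x\<close>, the agent's cost is
  \<open>(w x * dist x (l i) + A) / (w x + B)\<close> with \<open>A\<close>, \<open>B\<close>
  independent of \<open>x\<close>. That this is at least \<open>C\<close> means
  \<open>w x * (C - dist x (l i)) \<le> A - C * B\<close>, with equality at
  \<open>x = r i\<close>.\<close>

lemma pure_nash_best_response:
  assumes n: "n \<ge> 1" and D: "\<Delta> > 0" and nash: "pure_nash n \<Delta> ohat l r" and i: "i \<in> {1..n}"
  defines "C \<equiv> agent_cost n \<Delta> ohat l i r"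
  shows "(C - dist x (l i)) / (dist x ohat + \<Delta>) \<le>
    (C - dist (r i) (l i)) / (dist (r i) ohat + \<Delta>)"
proof -
  define w where "w y = 1 / (dist y ohat + \<Delta>)" for y
  define A where "A = (\<Sum>j\<in>{1..n} - {i}. w (r j) * dist (r j) (l i))"
  define B where "B = (\<Sum>j\<in>{1..n} - {i}. w (r j))"
  have w: "w y > 0" for y
    using D by (auto simp: w_def intro: add_nonneg_pos)
  have B: "B \<ge> 0"
    unfolding B_def using w by (intro sum_nonneg) (auto intro: less_imp_le)
  have cost: "agent_cost n \<Delta> ohat l i (r(i := y)) = (w y * dist y (l i) + A) / (w y + B)" for y
    using i by (simp add: agent_cost_eq_ratio[OF n D] sum.remove[of _ i] A_def B_def w_def)
  have "C = (w (r i) * dist (r i) (l i) + A) / (w (r i) + B)"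
    using cost[of "r i"] by (simp add: C_def)
  hence C: "C * (w (r i) + B) = w (r i) * dist (r i) (l i) + A"
    using w[of "r i"] B by (simp add: field_simps add_pos_nonneg)
  have "C \<le> (w x * dist x (l i) + A) / (w x + B)"
    using nash i unfolding pure_nash_def C_def cost[symmetric] by blast
  hence "C * (w x + B) \<le> w x * dist x (l i) + A"
    using w[of x] B by (simp add: pos_le_divide_eq add_pos_nonneg)
  with C have "w x * (C - dist x (l i)) \<le> w (r i) * (C - dist (r i) (l i))"
    by (simp add: algebra_simps)
  thus ?thesis
    by (simp add: w_def)
qed

lemma
  assumes n: "n \<ge> 1" and D: "\<Delta> > 0" and nash: "pure_nash n \<Delta> ohat l r" and i: "i \<in> {1..n}"
  shows pure_nash_dist_prediction_le: "dist (r i) ohat \<le> dist (l i) ohat" (is ?A)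
    and pure_nash_misreport_cost:
      "r i \<noteq> l i \<Longrightarrow> dist (l i) ohat + \<Delta> \<le> agent_cost n \<Delta> ohat l i r" (is "_ \<Longrightarrow> ?B")
    and pure_nash_dist_location_le: "dist (r i) (l i) \<le> dist (l i) ohat" (is ?C)
proof -
  define C a s d where "C = agent_cost n \<Delta> ohat l i r" and "a = dist (r i) ohat"
    and "s = dist (r i) (l i)" and "d = dist (l i) ohat"
  have nonneg: "C \<ge> 0" "a \<ge> 0" "s \<ge> 0" "d \<ge> 0"
    using agent_cost_nonneg[OF n D] by (auto simp: C_def a_def s_def d_def)
  have tri: "d \<le> a + s"
    unfolding a_def s_def d_def by (metis dist_commute dist_triangle add.commute)
  note best = pure_nash_best_response[OF n D nash i, folded C_def]
  \<comment> \<open>Truthful reporting is no better than \<open>r i\<close>. Both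
    \<open>a \<le> d\<close> and \<open>lie\<close> come from the cleared form \<open>truth\<close>,
    the latter through \<open>d - a \<le> s\<close>.\<close>
  have "C / (d + \<Delta>) \<le> (C - s) / (a + \<Delta>)"
    using best[of "l i"] by (simp add: a_def s_def d_def)
  hence truth: "s * (d + \<Delta>) \<le> C * (d - a)"
    using nonneg D by (simp add: field_simps)
  have a: "a \<le> d"
  proof (rule ccontr)
    assume "\<not> a \<le> d"
    hence "C * (d - a) \<le> 0"
      using nonneg by (intro mult_nonneg_nonpos) auto
    hence "s * (d + \<Delta>) \<le> 0"
      using truth by linarith
    hence "s = 0"
      using nonneg D by (auto simp: mult_le_0_iff)
    hence "a = d"
      by (simp add: a_def d_def s_def)
    thus False
      using \<open>\<not> a \<le> d\<close> by simp
  qed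
  thus ?A
    by (simp add: a_def d_def)
  have lie: "d + \<Delta> \<le> C" if "s > 0"
  proof -
    have "s * (d + \<Delta>) \<le> C * s"
      using truth mult_left_mono[of "d - a" s C] tri nonneg by linarith
    thus ?thesis
      using that by (simp add: mult.commute)
  qed
  thus ?B if "r i \<noteq> l i"
    using that by (simp add: s_def d_def C_def)
  have "s \<le> d"
  proof (cases "s > 0")
    case True
    have "(C - d) / \<Delta> \<le> (C - s) / (a + \<Delta>)"
      using best[of ohat] by (simp add: a_def s_def d_def dist_commute)
    hence "s * \<Delta> \<le> d * \<Delta> - (C - d) * a"
      using nonneg D by (simp add: field_simps)
    also have "\<dots> \<le> d * \<Delta>"
      using lie[OF True] nonneg D by simp
    finally show ?thesis
      using D by simp
  qed (use nonneg in linarith)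
  thus ?C
    by (simp add: s_def d_def)
qed

section \<open>Bounds from the mean distance to the prediction\<close>

text \<open>Jensen's inequality for the convex function \<open>1 / y\<close>: the denominators have
  mean at most \<open>m + \<Delta>\<close>.\<close>

lemma harmonic_normalizer_ge:
  assumes D: "\<Delta> > 0"
    and le: "(\<Sum>k\<in>{1..n}. dist (r k) ohat) \<le> real n * m" and m: "m \<ge> 0"
  shows "(\<Sum>k\<in>{1..n}. 1 / (dist (r k) ohat + \<Delta>)) \<ge> real n / (m + \<Delta>)"
proof -
  define M where "M = m + \<Delta>"
  have M: "M > 0"
    using m D by (simp add: M_def)
  \<comment> \<open>\<open>1 / y\<close> lies above its tangent at \<open>M\<close>\<close>
  have tangent: "2 / M - y / M^2 \<le> 1 / y" if "y > 0" for y
  proof -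
    have "0 \<le> (y - M)^2 / (y * M^2)"
      using that by simp
    also have "\<dots> = 1 / y - (2 / M - y / M^2)"
      using that M by (simp add: field_simps power2_eq_square)
    finally show ?thesis by simp
  qed
  have "real n / M = (2 * real n) / M - (real n * M) / M^2"
    using M by (simp add: field_simps power2_eq_square)
  also have "\<dots> \<le> (2 * real n) / M - (\<Sum>k\<in>{1..n}. dist (r k) ohat + \<Delta>) / M^2"
    using le by (intro diff_left_mono divide_right_mono) (auto simp: sum.distrib M_def algebra_simps)
  also have "\<dots> = (\<Sum>k\<in>{1..n}. 2 / M - (dist (r k) ohat + \<Delta>) / M^2)"
    by (simp add: sum_subtractf sum_divide_distrib)
  also have "\<dots> \<le> (\<Sum>k\<in>{1..n}. 1 / (dist (r k) ohat + \<Delta>))"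
    using D by (intro sum_mono tangent) (auto intro: add_nonneg_pos)
  finally show ?thesis
    by (simp add: M_def)
qed

text \<open>Every weight is at most \<open>1 / \<Delta>\<close>, while the normalizer is at least
  \<open>n / (m + \<Delta>)\<close>.\<close>

lemma harmonic_prob_le:
  assumes n: "n \<ge> 1" and D: "\<Delta> > 0"
    and le: "(\<Sum>k\<in>{1..n}. dist (r k) ohat) \<le> real n * m" and m: "m \<ge> 0"
  shows "harmonic_prob n \<Delta> ohat r j \<le> (m + \<Delta>) / (real n * \<Delta>)"
proof -
  have "harmonic_prob n \<Delta> ohat r j \<le> (1 / \<Delta>) / (real n / (m + \<Delta>))"
    unfolding harmonic_prob_def
    using harmonic_normalizer_ge[OF D le m] n D m
    by (intro frac_le) (auto intro!: divide_left_mono mult_pos_pos add_nonneg_pos)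
  thus ?thesis by (simp add: mult.commute)
qed

text \<open>A weight times its distance is \<open>1 - \<Delta>\<close> times the weight, so the
  expectation is exactly \<open>n / W - \<Delta>\<close>, the harmonic mean of the denominators less
  \<open>\<Delta>\<close>.\<close>

lemma expected_dist_prediction_le:
  assumes n: "n \<ge> 1" and D: "\<Delta> > 0"
    and le: "(\<Sum>k\<in>{1..n}. dist (r k) ohat) \<le> real n * m" and m: "m \<ge> 0"
  shows "(\<Sum>j\<in>{1..n}. harmonic_prob n \<Delta> ohat r j * dist (r j) ohat) \<le> m"
proof -
  define W where "W = (\<Sum>k\<in>{1..n}. 1 / (dist (r k) ohat + \<Delta>))"
  have W: "W > 0"
    using harmonic_normalizer_pos[OF n D] by (simp add: W_def)
  have ne: "dist (r j) ohat + \<Delta> \<noteq> 0" for j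
    using D by (smt (verit) zero_le_dist)
  have "harmonic_prob n \<Delta> ohat r j * dist (r j) ohat = 1 / W - \<Delta> * harmonic_prob n \<Delta> ohat r j" for j
    using W ne[of j] unfolding harmonic_prob_def W_def[symmetric]
    by (simp add: divide_simps)
  hence "(\<Sum>j\<in>{1..n}. harmonic_prob n \<Delta> ohat r j * dist (r j) ohat) = real n / W - \<Delta>"
    using sum_harmonic_prob[OF n D, of ohat r]
    by (simp add: sum_subtractf flip: sum_distrib_left)
  moreover have "real n / W \<le> m + \<Delta>"
    using harmonic_normalizer_ge[OF D le m] W m D unfolding W_def[symmetric] by (simp add: field_simps)
  ultimately show ?thesis by linarith
qed

section \<open>Expected social cost in equilibrium\<close>

lemma social_cost_le:
  "social_cost n l x \<le> real n * dist x y + social_cost n l y"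
proof -
  have "social_cost n l x \<le> (\<Sum>i\<in>{1..n}. dist x y + dist y (l i))"
    unfolding social_cost_def by (intro sum_mono dist_triangle)
  thus ?thesis by (simp add: social_cost_def sum.distrib)
qed

lemma pure_nash_robust:
  fixes l r :: "nat \<Rightarrow> 'a::metric_space"
  assumes n: "n \<ge> 1" and T: "social_cost n l ohat > 0" and c: "c > 0"
    and \<Delta>: "\<Delta> = c / real n * social_cost n l ohat"
    and nash: "pure_nash n \<Delta> ohat l r"
  shows "measure_pmf.expectation (harmonic n \<Delta> ohat r) (\<lambda>f. social_cost n l f)
    \<le> 24 * (1 + 1 / c^2) * social_cost n l q"
proof -
  define p where "p = harmonic_prob n \<Delta> ohat r"
  \<comment> \<open>\<open>m\<close> is the mean distance of the true locations from
    \<open>ohat\<close>, so \<open>\<Delta> = c * m\<close>. Below, \<open>q\<close> is the point to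
    compare with, and \<open>S\<close> is the expected distance between the report and the location
    of the selected agent.\<close>
  define m where "m = social_cost n l ohat / real n"
  define \<Omega> where "\<Omega> = social_cost n l q"
  define d where "d = dist q ohat"
  define s where "s j = dist (r j) (l j)" for j
  define Q where "Q = (\<Sum>j\<in>{1..n}. p j * dist q (l j))"
  define S where "S = (\<Sum>j\<in>{1..n}. p j * s j)"
  define L where "L = {j\<in>{1..n}. r j \<noteq> l j}"
  define P where "P = (\<Sum>j\<in>L. p j)"
  define E where "E = measure_pmf.expectation (harmonic n \<Delta> ohat r) (\<lambda>f. social_cost n l f)"
  have m: "m > 0" "real n * m = social_cost n l ohat" "\<Delta> = c * m" "\<Delta> > 0"
    using n T c by (auto simp: m_def \<Delta>)
  note D = m(4)
  have \<Omega>: "\<Omega> \<ge> 0"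
    by (simp add: \<Omega>_def social_cost_def sum_nonneg)
  have p0: "p j \<ge> 0" for j
    unfolding p_def using D by (rule harmonic_prob_nonneg)
  have p1: "(\<Sum>j\<in>{1..n}. p j) = 1"
    unfolding p_def using n D by (rule sum_harmonic_prob)
  have E: "E = (\<Sum>j\<in>{1..n}. p j * social_cost n l (r j))"
    unfolding E_def p_def using n D by (rule expectation_harmonic)
  have reports: "(\<Sum>k\<in>{1..n}. dist (r k) ohat) \<le> real n * m"
    unfolding m(2) social_cost_def
    using pure_nash_dist_prediction_le[OF n D nash] by (intro sum_mono) (simp add: dist_commute)
  \<comment> \<open>The first power of \<open>1 / c\<close> in the final bound enters here, through
    \<open>Q_le\<close>.\<close>
  have "(m + \<Delta>) / (real n * \<Delta>) = (1 + 1 / c) / real n"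
    using m(1) c n unfolding m(3) by (simp add: field_simps)
  hence p_le: "p j \<le> (1 + 1 / c) / real n" for j
    using harmonic_prob_le[OF n D reports, of j] m(1) by (simp add: p_def)
  have Q0: "Q \<ge> 0"
    unfolding Q_def by (intro sum_nonneg mult_nonneg_nonneg p0) auto
  have "Q \<le> (\<Sum>j\<in>{1..n}. (1 + 1 / c) / real n * dist q (l j))"
    unfolding Q_def by (intro sum_mono mult_right_mono p_le) auto
  also have "\<dots> = (1 + 1 / c) / real n * \<Omega>"
    by (simp add: \<Omega>_def social_cost_def sum_distrib_left)
  finally have Q_le: "real n * Q \<le> (1 + 1 / c) * \<Omega>"
    using n by (simp add: field_simps)
  have E_prediction: "E \<le> 2 * (real n * m)"
  proof -
    have "E \<le> (\<Sum>j\<in>{1..n}. p j * (real n * dist (r j) ohat + real n * m))"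
      unfolding E m(2) by (intro sum_mono mult_left_mono p0 social_cost_le)
    also have "\<dots> = real n * (\<Sum>j\<in>{1..n}. p j * dist (r j) ohat) + real n * m * (\<Sum>j\<in>{1..n}. p j)"
      by (simp add: sum.distrib sum_distrib_left algebra_simps)
    also have "\<dots> \<le> real n * m + real n * m"
      using expected_dist_prediction_le[OF n D reports, folded p_def] m(1) unfolding p1
      by (intro add_mono mult_left_mono) auto
    finally show ?thesis by (simp add: mult.commute)
  qed
  have dist_q: "dist (r j) q \<le> s j + dist q (l j)" for j
    unfolding s_def by (metis dist_triangle dist_commute)
  have E_opt: "E \<le> real n * (S + Q) + \<Omega>"
  proof -
    have "E \<le> (\<Sum>j\<in>{1..n}. p j * (real n * (s j + dist q (l j)) + \<Omega>))"
      unfolding E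
    proof (intro sum_mono mult_left_mono p0)
      fix j
      show "social_cost n l (r j) \<le> real n * (s j + dist q (l j)) + \<Omega>"
        using social_cost_le[of n l "r j" q] mult_left_mono[OF dist_q[of j], of "real n"]
        unfolding \<Omega>_def by linarith
    qed
    also have "\<dots> = real n * (S + Q) + \<Omega> * (\<Sum>j\<in>{1..n}. p j)"
      by (simp add: S_def Q_def sum.distrib sum_distrib_left algebra_simps)
    finally show ?thesis unfolding p1 by simp
  qed
  have L: "L \<subseteq> {1..n}" "finite L"
    by (auto simp: L_def)
  have P: "P \<ge> 0" "P \<le> 1"
    using sum_mono2[OF _ L(1), of p] p0 unfolding p1 by (auto simp: P_def sum_nonneg)
  have QL: "(\<Sum>j\<in>L. p j * dist q (l j)) \<le> Q"
    unfolding Q_def using p0 by (intro sum_mono2 L) auto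
  \<comment> \<open>Only agents in \<open>L\<close> contribute, each at most
    \<open>dist (l j) ohat\<close>, which is then estimated through \<open>q\<close>.\<close>
  have S: "S \<le> P * d + Q"
  proof -
    have "S = (\<Sum>j\<in>L. p j * s j)"
      unfolding S_def by (intro sum.mono_neutral_right) (auto simp: L_def s_def)
    also have "\<dots> \<le> (\<Sum>j\<in>L. p j * (d + dist q (l j)))"
    proof (intro sum_mono mult_left_mono p0)
      fix j assume "j \<in> L"
      hence "s j \<le> dist (l j) ohat"
        using pure_nash_dist_location_le[OF n D nash, of j] L(1) by (auto simp: s_def)
      also have "\<dots> \<le> d + dist q (l j)"
        unfolding d_def by (metis dist_triangle dist_commute add.commute)
      finally show "s j \<le> d + dist q (l j)" .
    qed
    also have "\<dots> \<le> P * d + Q"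
      using QL by (simp add: P_def sum.distrib sum_distrib_left algebra_simps)
    finally show ?thesis .
  qed
  \<comment> \<open>A misreporting agent's cost is at least
    \<open>dist (l j) ohat + \<Delta>\<close>. Routing that cost through \<open>q\<close> bounds it
    by \<open>S + Q + dist q (l j)\<close>; the second \<open>dist q (l j)\<close> comes from
    replacing \<open>dist (l j) ohat\<close> by \<open>d\<close>.\<close>
  have "(\<Sum>j\<in>L. p j * (d + \<Delta>)) \<le> (\<Sum>j\<in>L. p j * (2 * dist q (l j) + (S + Q)))"
  proof (intro sum_mono mult_left_mono p0)
    fix j assume j: "j \<in> L"
    have "dist (l j) ohat + \<Delta> \<le> (\<Sum>k\<in>{1..n}. p k * dist (r k) (l j))"
      using pure_nash_misreport_cost[OF n D nash, of j] j L(1)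
      by (auto simp: L_def p_def agent_cost_eq[OF n D])
    also have "\<dots> \<le> (\<Sum>k\<in>{1..n}. p k * (s k + dist q (l k) + dist q (l j)))"
      using dist_q by (intro sum_mono mult_left_mono p0) (smt (verit) dist_triangle)
    also have "\<dots> = S + Q + dist q (l j) * (\<Sum>k\<in>{1..n}. p k)"
      by (simp add: S_def Q_def sum.distrib sum_distrib_left algebra_simps)
    finally have "dist (l j) ohat + \<Delta> \<le> S + Q + dist q (l j)"
      unfolding p1 by simp
    moreover have "d \<le> dist q (l j) + dist (l j) ohat"
      unfolding d_def by (rule dist_triangle)
    ultimately show "d + \<Delta> \<le> 2 * dist q (l j) + (S + Q)"
      by linarith
  qed
  also have "\<dots> = 2 * (\<Sum>j\<in>L. p j * dist q (l j)) + P * (S + Q)"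
    by (simp add: P_def sum.distrib sum_distrib_left sum_distrib_right algebra_simps)
  \<comment> \<open>The bound on \<open>S\<close> reintroduces \<open>d\<close> with factor
    \<open>P * P\<close>. Absorbed on the left, it leaves \<open>P * (1 - P) * d\<close>, which
    controls \<open>P * d\<close> only if \<open>P\<close> stays away from 1; hence the case split
    below.\<close>
  also have "\<dots> \<le> 2 * Q + P * (P * d + Q + Q)"
    using QL S P by (intro add_mono mult_left_mono) auto
  also have "\<dots> \<le> 4 * Q + P * (P * d)"
    using mult_right_mono[OF P(2) Q0] by (simp add: algebra_simps)
  finally have key: "P * (1 - P) * d + P * \<Delta> \<le> 4 * Q"
    by (simp add: P_def algebra_simps sum.distrib sum_distrib_left)
  have d: "d \<ge> 0"
    by (simp add: d_def)
  \<comment> \<open>These are the coefficients of the two cases on \<open>P\<close>. Both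
    inequalities follow from \<open>2 * u \<le> 1 + u^2\<close>; applied to the second, it gives
    exactly 24 as the coefficient of \<open>u^2\<close>.\<close>
  have coeffs: "11 + 10 * (1 / c) \<le> 24 * (1 + 1 / c^2)"
    "16 * (1 / c + 1 / c^2) \<le> 24 * (1 + 1 / c^2)"
  proof -
    define u where "u = 1 / c"
    have u: "1 / c^2 = u^2"
      by (simp add: u_def power_one_over)
    have "0 \<le> 1 + u^2 - 2 * u"
      using zero_le_power2[of "1 - u"] by (simp add: power2_diff)
    thus "11 + 10 * (1 / c) \<le> 24 * (1 + 1 / c^2)" "16 * (1 / c + 1 / c^2) \<le> 24 * (1 + 1 / c^2)"
      unfolding u u_def[symmetric] distrib_left using zero_le_power2[of u] by - (linarith+)
  qed
  have "E \<le> 24 * (1 + 1 / c^2) * \<Omega>"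
  proof (cases "P \<le> 1 / 2")
    case True
    \<comment> \<open>Thus \<open>P * d \<le> 8 * Q\<close>, so \<open>S \<le> 9 * Q\<close>, and
      \<open>E_opt\<close> gives the bound.\<close>
    have "(1 / 2) * (P * d) \<le> (1 - P) * (P * d)"
      using True P d by (intro mult_right_mono) auto
    also have "\<dots> \<le> 4 * Q"
      using key mult_nonneg_nonneg[OF P(1) less_imp_le[OF D]] by (simp add: mult_ac)
    finally have "S + Q \<le> 10 * Q"
      using S by simp
    hence "E \<le> 10 * (real n * Q) + \<Omega>"
      using E_opt mult_left_mono[of "S + Q" "10 * Q" "real n"] by simp
    also have "\<dots> \<le> (11 + 10 * (1 / c)) * \<Omega>"
      using mult_left_mono[OF Q_le, of 10] by (simp add: algebra_simps)
    also have "\<dots> \<le> 24 * (1 + 1 / c^2) * \<Omega>"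
      using coeffs \<Omega> by (intro mult_right_mono) auto
    finally show ?thesis .
  next
    case False
    have "\<Delta> \<le> 2 * (P * \<Delta>)"
      using False D by simp
    moreover have "P * (1 - P) * d \<ge> 0"
      using P d by simp
    ultimately have "\<Delta> \<le> 8 * Q"
      using key by linarith
    \<comment> \<open>Since \<open>\<Delta> = c * m\<close>, solving for \<open>real n * m\<close>,
      the social cost of \<open>ohat\<close>, divides by \<open>c\<close> and yields the second
      power of \<open>1 / c\<close>. \<open>E_prediction\<close> then bounds
      \<open>E\<close>.\<close>
    hence "c * (real n * m) \<le> 8 * (real n * Q)"
      using mult_left_mono[of \<Delta> "8 * Q" "real n"] m(3) by (simp add: mult_ac)
    also have "\<dots> \<le> 8 * ((1 + 1 / c) * \<Omega>)"
      using Q_le by simp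
    finally have "real n * m \<le> 8 * ((1 + 1 / c) * \<Omega>) / c"
      using c by (simp add: pos_le_divide_eq mult.commute)
    also have "\<dots> = 8 * ((1 / c + 1 / c^2) * \<Omega>)"
      by (simp add: power2_eq_square add_divide_distrib distrib_left distrib_right)
    finally have "E \<le> 16 * ((1 / c + 1 / c^2) * \<Omega>)"
      using E_prediction by linarith
    also have "\<dots> = 16 * (1 / c + 1 / c^2) * \<Omega>"
      by simp
    also have "\<dots> \<le> 24 * (1 + 1 / c^2) * \<Omega>"
      using coeffs \<Omega> by (intro mult_right_mono) auto
    finally show ?thesis .
  qed
  thus ?thesis
    by (simp add: E_def \<Omega>_def)
qed

theorem theorem4p6:
  fixes l r :: "nat \<Rightarrow> 'a::strictly_convex_space"
    and ohat :: 'a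
    and n :: nat
    and c \<Delta> :: real
  assumes "n \<ge> 1"
    and "\<exists>f. social_cost n l f = opt n l"
    and "social_cost n l ohat > 0"
    and "c > 0"
    and "\<Delta> = c / real n * social_cost n l ohat"
    and "pure_nash n \<Delta> ohat l r"
  shows "measure_pmf.expectation (harmonic n \<Delta> ohat r) (\<lambda>f. social_cost n l f)
    \<le> robustness_const * (1 + 1 / c^2) * opt n l"
proof -
  obtain q where q: "social_cost n l q = opt n l"
    using assms(2) by blast
  \<comment> \<open>Nonnegativity permits enlarging the factor 24 to
    \<open>robustness_const\<close>.\<close>
  have "opt n l \<ge> 0"
    unfolding q[symmetric] social_cost_def by (intro sum_nonneg) simp
  hence "24 * (1 + 1 / c^2) * opt n l \<le> robustness_const * (1 + 1 / c^2) * opt n l"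
    by (intro mult_right_mono) (auto simp: robustness_const_def)
  with pure_nash_robust[OF assms(1,3-6), of q] show ?thesis
    unfolding q by linarith
qed

end
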